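(* Let $0<\lambda<2$ and $\alpha\ge 0$. Then $h_\alpha\in\mathcal{TBF}_\lambda$ if and only if $\alpha=0$.
   Context: For $\alpha\ge 0$ and $x>0$, $h_\alpha(x)=(1+1/x)^{\alpha x}:=\exp(\alpha x\log(1+1/x))$. A $C^\infty$-function $f:(0,\infty)\to[0,\infty)$ is completely monotonic if $(-1)^n f^{(n)}(x)\ge 0$ for all $n\ge 0$, $x>0$. A $C^\infty$-function $f:(0,\infty)\to[0,\infty)$ is a Bernstein function ($f\in\mathcal{BF}$) if $f'$ is completely monotonic. For $\lambda>0$, a function $f:(0,\infty)\to\mathbb{R}$ is a generalized Stieltjes function of order $\lambda$ ($f\in\mathcal S_\lambda$) if $$f(x)=\int_0^\infty\frac{d\mu(t)}{(x+t)^\lambda}+c,\quad x>0,$$ where $\mu$ is a positive measure on $[0,\infty)$ making the integral converge for $x>0$ and $c\ge 0$. For $\lambda>0$, $\mathcal{TBF}_\lambda=\{f\in\mathcal{BF}\mid f'\in\mathcal S_\lambda\}$. *)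

theory Defs
  imports "HOL-Analysis.Analysis"
begin

(* Functions on (0,\<infinity>) are total functions of type real \<Rightarrow> real of which only the values at
   x > 0 matter. Since (0,\<infinity>) is open, the iterates of deriv at x > 0 do not see the other values. *)

definition smooth_pos :: "(real \<Rightarrow> real) \<Rightarrow> bool" where
  "smooth_pos f \<longleftrightarrow> (\<forall>n. \<forall>x>0. (deriv ^^ n) f differentiable (at x))"

definition completely_monotonic :: "(real \<Rightarrow> real) \<Rightarrow> bool" where
  "completely_monotonic f \<longleftrightarrow>
     smooth_pos f \<and> (\<forall>n. \<forall>x>0. (- 1) ^ n * (deriv ^^ n) f x \<ge> 0)"

definition BF :: "(real \<Rightarrow> real) set" where
  "BF = {f. smooth_pos f \<and> (\<forall>x>0. f x \<ge> 0) \<and> completely_monotonic (deriv f)}"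

definition Stieltjes :: "real \<Rightarrow> (real \<Rightarrow> real) set" where
  "Stieltjes lam = {f. \<exists>(\<mu> :: real measure) c.
     sets \<mu> = sets (restrict_space borel {0..}) \<and> c \<ge> 0 \<and>
     (\<forall>x>0. integrable \<mu> (\<lambda>t. 1 / (x + t) powr lam) \<and>
            f x = (\<integral>t. 1 / (x + t) powr lam \<partial>\<mu>) + c)}"

definition TBF :: "real \<Rightarrow> (real \<Rightarrow> real) set" where
  "TBF lam = {f \<in> BF. deriv f \<in> Stieltjes lam}"

definition h :: "real \<Rightarrow> real \<Rightarrow> real" where
  "h \<alpha> x = exp (\<alpha> * x * ln (1 + 1 / x))"

end

(* If h' = h_alpha' is in S_lam, then x^lam h'(x) is nondecreasing, because each x^lam/(x+t)^lam is
   nondecreasing in x. But 0 < h'(x) <= alpha e^alpha / x^2, so x^lam h'(x) tends to 0 when lam < 2: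
   a positive nondecreasing function cannot do that. *)

theory Submission
  imports Defs
begin

text \<open>Integrating the pointwise monotonicity of the rescaled kernel against \<mu> settles the
  integral part. The constant contributes \<open>c * x powr lam\<close>, which is nondecreasing
  because \<open>c\<close> and \<open>lam\<close> are nonnegative.\<close>

lemma Stieltjes_powr_mono:
  assumes f: "f \<in> Stieltjes lam" and lam: "0 < lam" and xy: "0 < x" "x \<le> y"
  shows "x powr lam * f x \<le> y powr lam * f y"
proof -
  obtain \<mu> :: "real measure" and c where sets: "sets \<mu> = sets (restrict_space borel {0..})"
    and c: "c \<ge> 0"
    and int: "\<And>x. x > 0 \<Longrightarrow> integrable \<mu> (\<lambda>t. 1 / (x + t) powr lam)"
    and eq: "\<And>x. x > 0 \<Longrightarrow> f x = (\<integral>t. 1 / (x + t) powr lam \<partial>\<mu>) + c"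
    using f unfolding Stieltjes_def by blast
  have space: "space \<mu> = {0..}"
    using sets_eq_imp_space_eq[OF sets] by (simp add: space_restrict_space)
  have y: "y > 0" using xy by simp
  have "x powr lam * (\<integral>t. 1 / (x + t) powr lam \<partial>\<mu>) = (\<integral>t. x powr lam * (1 / (x + t) powr lam) \<partial>\<mu>)"
    by (rule integral_mult_right_zero [symmetric])
  also have "\<dots> \<le> (\<integral>t. y powr lam * (1 / (y + t) powr lam) \<partial>\<mu>)"
  proof (rule integral_mono)
    fix t assume "t \<in> space \<mu>"
    then have t: "t \<ge> 0" using space by simp
    \<comment> \<open>After clearing denominators this is \<open>x * t \<le> y * t\<close>, so it
      rests on \<mu> living on the half-line \<open>{0..}\<close>.\<close>
    then have "x / (x + t) \<le> y / (y + t)"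
      using xy by (simp add: field_simps mult_left_mono)
    then have "(x / (x + t)) powr lam \<le> (y / (y + t)) powr lam"
      using xy t lam by (intro powr_mono2) auto
    then show "x powr lam * (1 / (x + t) powr lam) \<le> y powr lam * (1 / (y + t) powr lam)"
      using xy t by (simp add: powr_divide)
  qed (intro integrable_mult_right int xy y)+
  also have "\<dots> = y powr lam * (\<integral>t. 1 / (y + t) powr lam \<partial>\<mu>)"
    by (rule integral_mult_right_zero)
  finally have *: "x powr lam * (\<integral>t. 1 / (x + t) powr lam \<partial>\<mu>)
      \<le> y powr lam * (\<integral>t. 1 / (y + t) powr lam \<partial>\<mu>)" .
  have "x powr lam * c \<le> y powr lam * c"
    using xy lam c by (intro mult_right_mono powr_mono2) auto
  with * show ?thesis
    using eq[OF xy(1)] eq[OF y] by (simp add: distrib_left)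
qed

lemma deriv_h:
  assumes "x > 0"
  shows "deriv (h \<alpha>) x = \<alpha> * h \<alpha> x * (ln (1 + 1 / x) - 1 / (x + 1))"
proof -
  have "1 + 1 / x > 0" using assms by (simp add: add_pos_pos)
  then have "((\<lambda>x. exp (\<alpha> * x * ln (1 + 1 / x))) has_real_derivative
      exp (\<alpha> * x * ln (1 + 1 / x)) *
        (\<alpha> * ln (1 + 1 / x) + \<alpha> * x * (- 1 / x\<^sup>2 / (1 + 1 / x)))) (at x)"
    using assms by (auto intro!: derivative_eq_intros simp: power2_eq_square)
  moreover have "\<alpha> * ln (1 + 1 / x) + \<alpha> * x * (- 1 / x\<^sup>2 / (1 + 1 / x))
      = \<alpha> * (ln (1 + 1 / x) - 1 / (x + 1))"
  proof -
    \<comment> \<open>With the sum as one fraction, the powers of \<open>x\<close> cancel and the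
      chain-rule term collapses to \<open>- 1 / (x + 1)\<close>.\<close>
    have "1 + 1 / x = (x + 1) / x"
      using assms by (simp add: field_simps)
    then have "x * (- 1 / x\<^sup>2 / (1 + 1 / x)) = - (1 / (x + 1))"
      using assms by (simp add: power2_eq_square)
    then show ?thesis
      by (simp only: mult.assoc distrib_left mult_minus_right diff_conv_add_uminus)
  qed
  ultimately have "((\<lambda>x. exp (\<alpha> * x * ln (1 + 1 / x))) has_real_derivative
      exp (\<alpha> * x * ln (1 + 1 / x)) * (\<alpha> * (ln (1 + 1 / x) - 1 / (x + 1)))) (at x)"
    by (simp only:)
  then have "(h \<alpha> has_real_derivative
      \<alpha> * h \<alpha> x * (ln (1 + 1 / x) - 1 / (x + 1))) (at x)"
    unfolding h_def [abs_def] by (simp only: mult_ac)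
  then show ?thesis by (rule DERIV_imp_deriv)
qed

text \<open>The inequality \<open>ln (1 + u) \<le> u\<close> at \<open>u = 1 / x\<close> is used
  twice: it bounds the exponent of \<open>h\<close> by \<alpha>, and it bounds the logarithmic
  factor by \<open>1 / x - 1 / (x + 1)\<close>, where the terms of order \<open>1 / x\<close>
  cancel. The resulting decay exponent 2 is the source of the threshold
  \<open>lam < 2\<close>.\<close>

lemma deriv_h_le:
  assumes x: "x > 0" and \<alpha>: "\<alpha> \<ge> 0"
  shows "deriv (h \<alpha>) x \<le> \<alpha> * exp \<alpha> * x powr -2"
proof -
  have ln: "ln (1 + 1 / x) \<le> 1 / x"
    using x by (intro ln_add_one_self_le_self) simp
  have "x * ln (1 + 1 / x) \<le> 1"
    using mult_left_mono[OF ln, of x] x by simp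
  then have "\<alpha> * (x * ln (1 + 1 / x)) \<le> \<alpha> * 1"
    using \<alpha> by (rule mult_left_mono)
  then have h: "h \<alpha> x \<le> exp \<alpha>"
    by (simp add: h_def mult.assoc)
  have "ln (1 + 1 / x) - 1 / (x + 1) \<le> 1 / x - 1 / (x + 1)"
    using ln by simp
  also have "\<dots> = 1 / (x * (x + 1))"
    using x by (simp add: divide_simps)
  also have "\<dots> \<le> 1 / (x * x)"
    using x by (intro divide_left_mono mult_left_mono) auto
  also have "\<dots> = x powr -2"
    using x by (simp add: powr_minus divide_inverse power2_eq_square)
  finally have "ln (1 + 1 / x) - 1 / (x + 1) \<le> x powr -2" .
  then have "\<alpha> * h \<alpha> x * (ln (1 + 1 / x) - 1 / (x + 1)) \<le> \<alpha> * h \<alpha> x * x powr -2"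
    using \<alpha> by (intro mult_left_mono) (auto simp: h_def)
  also have "\<dots> \<le> \<alpha> * exp \<alpha> * x powr -2"
    using \<alpha> h by (intro mult_right_mono mult_left_mono) auto
  finally show ?thesis by (simp add: deriv_h[OF x])
qed

lemma deriv_h_not_Stieltjes:
  assumes lam: "0 < lam" "lam < 2" and \<alpha>: "\<alpha> > 0"
  shows "deriv (h \<alpha>) \<notin> Stieltjes lam"
proof
  assume S: "deriv (h \<alpha>) \<in> Stieltjes lam"
  \<comment> \<open>The base point 1 is convenient because \<open>1 powr lam = 1\<close>, so the
    weight disappears on the left.\<close>
  have "deriv (h \<alpha>) 1 \<le> \<alpha> * exp \<alpha> * x powr (lam - 2)" if "x \<ge> 1" for x
  proof -
    have "deriv (h \<alpha>) 1 \<le> x powr lam * deriv (h \<alpha>) x"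
      using Stieltjes_powr_mono[OF S lam(1) _ that] by simp
    also have "\<dots> \<le> x powr lam * (\<alpha> * exp \<alpha> * x powr -2)"
      using deriv_h_le[of x \<alpha>] that \<alpha> by (intro mult_left_mono) auto
    also have "\<dots> = \<alpha> * exp \<alpha> * x powr (lam - 2)"
      using powr_add[of x lam "-2"] by (simp add: mult_ac)
    finally show ?thesis .
  qed
  then have "\<forall>\<^sub>F x in at_top. deriv (h \<alpha>) 1 \<le> \<alpha> * exp \<alpha> * x powr (lam - 2)"
    by (auto simp: eventually_at_top_linorder)
  moreover have "((\<lambda>x. \<alpha> * exp \<alpha> * x powr (lam - 2)) \<longlongrightarrow> \<alpha> * exp \<alpha> * 0) at_top"
    using lam by (intro tendsto_mult_left tendsto_neg_powr filterlim_ident) auto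
  ultimately have "deriv (h \<alpha>) 1 \<le> 0"
    by (intro tendsto_lowerbound[where F = at_top]) auto
  \<comment> \<open>The last factor of the derivative at 1 is \<open>ln 2 - 1 / 2\<close>, positive
    since \<open>ln 2 \<ge> 2 / 3\<close>.\<close>
  moreover have "deriv (h \<alpha>) 1 > 0"
    using deriv_h[of 1 \<alpha>]  \<alpha> ln2_ge_two_thirds by (simp add: h_def)
  ultimately show False by simp
qed

lemma funpow_deriv_const:
  "(deriv ^^ n) (\<lambda>x. c :: real) = (\<lambda>x. if n = 0 then c else 0)"
  by (induction n) auto

lemma const_in_BF:
  assumes "c \<ge> 0"
  shows "(\<lambda>x. c) \<in> BF"
  using assms
  by (auto simp: BF_def completely_monotonic_def smooth_pos_def funpow_deriv_const)

lemma zero_in_Stieltjes: "(\<lambda>x. 0) \<in> Stieltjes lam"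
  unfolding Stieltjes_def mem_Collect_eq
proof (intro exI[of _ "null_measure (restrict_space borel {0..})"] exI[of _ 0] conjI allI impI)
  fix x :: real
  \<comment> \<open>Integrability includes measurability, so this must be checked even though the
    null measure makes every integral vanish.\<close>
  have "(\<lambda>t. 1 / (x + t) powr lam) \<in> borel_measurable (restrict_space borel {0..})"
    by (rule measurable_restrict_space1) simp
  then show "integrable (null_measure (restrict_space borel {0..})) (\<lambda>t. 1 / (x + t) powr lam)"
    by simp
  show "0 = (\<integral>t. 1 / (x + t) powr lam \<partial>null_measure (restrict_space borel {0..})) + 0"
    by simp
qed auto

theorem mainTheorem2:
  fixes lam \<alpha> :: real
  assumes "0 < lam" and "lam < 2" and "\<alpha> \<ge> 0"
  shows "h \<alpha> \<in> TBF lam \<longleftrightarrow> \<alpha> = 0"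
proof
  assume "h \<alpha> \<in> TBF lam"
  then show "\<alpha> = 0"
    using deriv_h_not_Stieltjes[of lam \<alpha>] assms by (force simp: TBF_def)
next
  assume "\<alpha> = 0"
  \<comment> \<open>The exponent vanishes at every real \<open>x\<close>, not only at positive ones,
    so this is an equality of total functions and \<open>deriv (h \<alpha>)\<close> is the zero
    function.\<close>
  then have "h \<alpha> = (\<lambda>x. 1)"
    by (simp add: h_def fun_eq_iff)
  then show "h \<alpha> \<in> TBF lam"
    using const_in_BF[of 1] zero_in_Stieltjes[of lam] by (simp add: TBF_def)
qed

end
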